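(* Let $m>1$, let $X\neq\emptyset$ be a finite set, $k:X\times X\to[0,\infty)$, and assume that the operator $L$ generated by $k$ satisfies the condition $CD_{m,\alpha}(0,d)$ for some $d>0$ and $\alpha\in[0,1]$. Suppose that $u:[0,\infty)\times X\to(0,\infty)$ is $C^1$ in time and solves the porous medium equation $\partial_t u-Lu^m=0$ on $(0,\infty)\times X$. Then the function $v=\frac{m}{m-1}u^{m-1}$ satisfies $$-\Big(Lv+\alpha\frac{\tilde{\Psi}_\Upsilon^{(m)}(v)}{(m-1)v}\Big)\le\frac dt\quad\text{in }(0,\infty)\times X,$$ and thus $$(1-\alpha)\frac{\tilde{\Psi}_\Upsilon^{(m)}(v)}{(m-1)v}-\frac{\partial_t v}{(m-1)v}\le\frac dt\quad\text{in }(0,\infty)\times X.$$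
   Context: For $f:X\to\mathbb{R}$ the operator generated by $k$ is $Lf(x)=\sum_{y\in X}k(x,y)(f(y)-f(x))$; one sets $k(x,x)=0$, and $k$ is assumed nontrivial (not identically zero). For $w:X\to(0,\infty)$ and $m>1$, $$\tilde{\Psi}_\Upsilon^{(m)}(w)(x)=\sum_{y\in X}k(x,y)\Big(\tfrac{m-1}{m}w(x)^2+\tfrac{(m-1)^2}{m}w(x)^{\frac{m-2}{m-1}}w(y)^{\frac{m}{m-1}}-(m-1)w(x)w(y)\Big).$$ For $u:X\to(0,\infty)$, $m>1$ and $\alpha\in[0,1]$, $$\mathcal{D}_{m,\alpha}(u)(x)=\sum_{y\in X}k(x,y)\Big(\Big(1-\alpha+\alpha\tfrac{u(y)}{u(x)}\Big)m\,u^{m-2}(y)Lu^m(y)-\Big(m-\alpha+\alpha\big(\tfrac{u(y)}{u(x)}\big)^m\Big)u^{m-2}(x)Lu^m(x)\Big).$$ Condition $CD_{m,\alpha}(0,d)$ at $x\in X$: for every $u:X\to(0,\infty)$, with $v=\frac{m}{m-1}u^{m-1}$ and $G=Lv+\alpha\frac{\tilde{\Psi}_\Upsilon^{(m)}(v)}{(m-1)v}$, such that $-G(x)>0$ and $-G(x)\ge -G(y)$ for all $y\in X$ with $k(x,y)>0$, one has $$\mathcal{D}_{m,\alpha}(u)(x)\ge\frac1d\big(-G(x)\big)^2.$$ $L$ satisfies $CD_{m,\alpha}(0,d)$ if it satisfies it at every $x\in X$. For functions of $(t,x)$, the operators act in the variable $x$ for each fixed $t$. *)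

theory Defs
  imports "HOL-Analysis.Analysis"
begin

text \<open>The finite nonempty state space is a type of class \<open>finite\<close>, and
  \<open>k x y\<close> is the jump rate from \<open>x\<close> to \<open>y\<close>. All real powers are taken with
  \<open>powr\<close>; they are only applied to positive bases.\<close>

definition is_kernel :: "('a::finite \<Rightarrow> 'a \<Rightarrow> real) \<Rightarrow> bool" where
  "is_kernel k \<longleftrightarrow>
     (\<forall>x y. 0 \<le> k x y) \<and> (\<forall>x. k x x = 0) \<and> (\<exists>x y. k x y \<noteq> 0)"

definition gen :: "('a::finite \<Rightarrow> 'a \<Rightarrow> real) \<Rightarrow> ('a \<Rightarrow> real) \<Rightarrow> 'a \<Rightarrow> real" where
  "gen k f x = (\<Sum>y\<in>UNIV. k x y * (f y - f x))"

definition Psi_tilde ::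
  "('a::finite \<Rightarrow> 'a \<Rightarrow> real) \<Rightarrow> real \<Rightarrow> ('a \<Rightarrow> real) \<Rightarrow> 'a \<Rightarrow> real" where
  "Psi_tilde k m w x = (\<Sum>y\<in>UNIV. k x y *
     ((m - 1) / m * (w x)\<^sup>2
      + (m - 1)\<^sup>2 / m * w x powr ((m - 2) / (m - 1)) * w y powr (m / (m - 1))
      - (m - 1) * w x * w y))"

definition D_op ::
  "('a::finite \<Rightarrow> 'a \<Rightarrow> real) \<Rightarrow> real \<Rightarrow> real \<Rightarrow> ('a \<Rightarrow> real) \<Rightarrow> 'a \<Rightarrow> real" where
  "D_op k m \<alpha> u x = (\<Sum>y\<in>UNIV. k x y *
     ((1 - \<alpha> + \<alpha> * (u y / u x)) * m * u y powr (m - 2) * gen k (\<lambda>z. u z powr m) y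
      - (m - \<alpha> + \<alpha> * (u y / u x) powr m) * u x powr (m - 2) * gen k (\<lambda>z. u z powr m) x))"

definition pressure :: "real \<Rightarrow> ('a \<Rightarrow> real) \<Rightarrow> 'a \<Rightarrow> real" where
  "pressure m u x = m / (m - 1) * u x powr (m - 1)"

definition G_op ::
  "('a::finite \<Rightarrow> 'a \<Rightarrow> real) \<Rightarrow> real \<Rightarrow> real \<Rightarrow> ('a \<Rightarrow> real) \<Rightarrow> 'a \<Rightarrow> real" where
  "G_op k m \<alpha> v x = gen k v x + \<alpha> * (Psi_tilde k m v x / ((m - 1) * v x))"

text \<open>The \<open>0\<close> in \<open>CD0\<close> is the curvature bound in $CD_{m,\alpha}(0,d)$; the test functions \<open>u\<close>
  range over all positive functions of space alone.\<close>

definition CD0_at ::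
  "('a::finite \<Rightarrow> 'a \<Rightarrow> real) \<Rightarrow> real \<Rightarrow> real \<Rightarrow> real \<Rightarrow> 'a \<Rightarrow> bool" where
  "CD0_at k m \<alpha> d x \<longleftrightarrow>
     (\<forall>u. (\<forall>y. 0 < u y) \<longrightarrow>
        (let G = G_op k m \<alpha> (pressure m u) in
          - G x > 0 \<and> (\<forall>y. k x y > 0 \<longrightarrow> - G x \<ge> - G y) \<longrightarrow>
          D_op k m \<alpha> u x \<ge> 1 / d * (- G x)\<^sup>2))"

definition CD0 :: "('a::finite \<Rightarrow> 'a \<Rightarrow> real) \<Rightarrow> real \<Rightarrow> real \<Rightarrow> real \<Rightarrow> bool" where
  "CD0 k m \<alpha> d \<longleftrightarrow> (\<forall>x. CD0_at k m \<alpha> d x)"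

text \<open>Functions of time and space are curried as \<open>u t x\<close>; only times \<open>t \<ge> 0\<close> matter.
  \<open>C1_in_time\<close> is \<open>C\<^sup>1\<close> on the closed half-line, with the one-sided derivative at \<open>t = 0\<close>
  (which the library's \<open>C1_differentiable_on\<close>, using \<open>at t\<close>, does not express).\<close>

definition C1_in_time :: "(real \<Rightarrow> 'a \<Rightarrow> real) \<Rightarrow> bool" where
  "C1_in_time u \<longleftrightarrow>
     (\<forall>x. \<exists>u'. continuous_on {0..} u' \<and>
        (\<forall>t\<ge>0. ((\<lambda>s. u s x) has_real_derivative u' t) (at t within {0..})))"

definition solves_PME :: "('a::finite \<Rightarrow> 'a \<Rightarrow> real) \<Rightarrow> real \<Rightarrow> (real \<Rightarrow> 'a \<Rightarrow> real) \<Rightarrow> bool" where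
  "solves_PME k m u \<longleftrightarrow>
     (\<forall>t>0. \<forall>x. deriv (\<lambda>s. u s x) t - gen k (\<lambda>y. u t y powr m) x = 0)"

end

theory Submission
  imports Defs
begin

text \<open>Along a positive solution, \<open>G = Lv + \<alpha> \<Psi>(v) / ((m - 1) v)\<close> satisfies
  \<open>\<partial>\<^sub>t G = D(u)\<close>. Where \<open>- t G\<close> attains a positive maximum over
  \<open>[0,T] \<times> X\<close>, at a time \<open>t > 0\<close>, the curvature condition applies, since the point also maximises
  \<open>- G(t,\<sqdot>)\<close> in space; the sign of the time derivative then gives
  \<open>0 \<le> - G - t D(u) \<le> - G - t G\<^sup>2 / d\<close>, that is, \<open>- t G \<le> d\<close>.\<close>

section \<open>Maximum principle for Riccati-type inequalities\<close>

lemma riccati_maximum_principle: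
  fixes F F' :: "real \<Rightarrow> 'a::finite \<Rightarrow> real"
  assumes cont: "\<And>x. continuous_on {0..} (\<lambda>t. F t x)"
    and deriv: "\<And>t x. t > 0 \<Longrightarrow> ((\<lambda>s. F s x) has_real_derivative F' t x) (at t)"
    and riccati: "\<And>t x. \<lbrakk>t > 0; F t x > 0; \<And>y. F t y \<le> F t x\<rbrakk> \<Longrightarrow> F' t x \<le> - (1 / d * (F t x)\<^sup>2)"
    and "d > 0" "T > 0"
  shows "F T x \<le> d / T"
proof -
  \<comment> \<open>Time maximisers are chosen for each state separately, by compactness of
    \<open>{0..T}\<close>; finiteness of the state space then turns them into a joint maximum in
    time and space.\<close>
  have "\<exists>t\<in>{0..T}. \<forall>s\<in>{0..T}. s * F s y \<le> t * F t y" for y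
    by (intro continuous_attains_sup continuous_intros continuous_on_subset[OF cont])
      (use \<open>T > 0\<close> in auto)
  then obtain \<tau> where \<tau>: "\<And>y. \<tau> y \<in> {0..T}"
    and \<tau>_max: "\<And>y s. s \<in> {0..T} \<Longrightarrow> s * F s y \<le> \<tau> y * F (\<tau> y) y"
    by metis
  have "finite (range (\<lambda>y. \<tau> y * F (\<tau> y) y))" by simp
  from Max_in[OF this] obtain x0
    where x0: "Max (range (\<lambda>y. \<tau> y * F (\<tau> y) y)) = \<tau> x0 * F (\<tau> x0) x0" by blast
  define t where "t = \<tau> x0"
  have t: "0 \<le> t" "t \<le> T" using \<tau>[of x0] by (auto simp: t_def)
  have max: "s * F s y \<le> t * F t x0" if "s \<in> {0..T}" for s y
  proof -
    have "\<tau> y * F (\<tau> y) y \<le> t * F t x0"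
      unfolding t_def x0[symmetric] by (rule Max_ge) auto
    with \<tau>_max[OF that, of y] show ?thesis by linarith
  qed
  have "t * F t x0 \<le> d"
  proof (cases "t * F t x0 > 0")
    case True
    with t have "t > 0" "F t x0 > 0" by (auto simp: zero_less_mult_iff)
    \<comment> \<open>Comparing values at the common time \<open>t\<close> and cancelling the factor
      \<open>t > 0\<close> shows that \<open>x0\<close> maximises \<open>F t\<close> in space, as
      the Riccati hypothesis requires.\<close>
    have "F t y \<le> F t x0" for y
      using max[of t y] t \<open>t > 0\<close> by simp
    then have ric: "F' t x0 \<le> - (1 / d * (F t x0)\<^sup>2)"
      using riccati \<open>t > 0\<close> \<open>F t x0 > 0\<close> by blast
    have der: "((\<lambda>s. s * F s x0) has_real_derivative F t x0 + t * F' t x0) (at t)"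
      using deriv[OF \<open>t > 0\<close>] by (auto intro!: derivative_eq_intros)
    have "0 \<le> F t x0 + t * F' t x0"
    \<comment> \<open>The maximum may sit at the endpoint \<open>t = T\<close>, so only earlier
      times are available for comparison: a negative derivative would make the function larger just
      before \<open>t\<close>.\<close>
    proof (rule ccontr)
      assume "\<not> ?thesis"
      then obtain e where e: "e > 0" "\<And>h. \<lbrakk>h > 0; h < e\<rbrakk> \<Longrightarrow> t * F t x0 < (t - h) * F (t - h) x0"
        using DERIV_neg_dec_left[OF der] by auto
      \<comment> \<open>Halving \<open>e\<close> gives \<open>h < e\<close>; the bound by
        \<open>t\<close> keeps \<open>t - h\<close> nonnegative.\<close>
      define h where "h = min (e / 2) t"
      have "h > 0" "h < e" "t - h \<in> {0..T}" using e(1) \<open>t > 0\<close> t by (auto simp: h_def)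
      then show False using e(2)[of h] max[of "t - h" x0] by simp
    qed
    also have "\<dots> \<le> F t x0 - t * (1 / d * (F t x0)\<^sup>2)"
      using mult_left_mono[OF ric t(1)] by simp
    \<comment> \<open>With \<open>F t x0 > 0\<close> and \<open>d > 0\<close>, nonnegativity of this
      expression forces \<open>t * F t x0 \<le> d\<close>.\<close>
    also have "\<dots> = F t x0 * (d - t * F t x0) / d"
      using \<open>d > 0\<close> by (simp add: field_simps power2_eq_square)
    finally show ?thesis
      using \<open>F t x0 > 0\<close> \<open>d > 0\<close> by (simp add: zero_le_divide_iff zero_le_mult_iff)
  qed (use \<open>d > 0\<close> in simp)
  then have "T * F T x \<le> d" using max[of T x] \<open>T > 0\<close> by simp
  then show ?thesis using \<open>T > 0\<close> by (simp add: field_simps)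
qed

section \<open>Rewriting the operators of the pressure in terms of powers of
  \<open>u\<close>\<close>

lemma gen_pressure:
  "gen k (pressure m u) x =
    (\<Sum>y\<in>UNIV. k x y * (m / (m - 1) * (u y powr (m - 1) - u x powr (m - 1))))"
  by (simp add: gen_def pressure_def right_diff_distrib)

text \<open>The exponents in \<open>Psi_tilde\<close> are matched to the pressure: they turn powers
  of v into \<open>u x powr (m - 2)\<close> and \<open>u y powr m\<close>. They also add up to 2, so
  the constant m/(m-1) enters each summand squared and a common factor
  \<open>(m - 1) * pressure m u x\<close> can be pulled out.\<close>

lemma Psi_tilde_pressure:
  fixes u :: "'a::finite \<Rightarrow> real"
  assumes "m > 1" and u: "\<And>y. u y > 0"
  shows "Psi_tilde k m (pressure m u) x / ((m - 1) * pressure m u x) =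
    (\<Sum>y\<in>UNIV. k x y *
      (u x powr (m - 1) / (m - 1) + u y powr m / u x - m / (m - 1) * u y powr (m - 1)))"
proof -
  let ?v = "pressure m u"
  define c where "c = m / (m - 1)"
  have c: "c > 0" using \<open>m > 1\<close> by (simp add: c_def)
  have v: "?v y = c * u y powr (m - 1)" for y by (simp add: pressure_def c_def)
  have v_pos: "?v y > 0" for y using c u[of y] by (simp add: v)
  have power: "?v x powr ((m - 2) / (m - 1)) * ?v y powr (m / (m - 1)) = c * ?v x * (u y powr m / u x)" for y
  proof -
    have x: "?v x powr ((m - 2) / (m - 1)) = c powr ((m - 2) / (m - 1)) * u x powr (m - 2)"
      and y: "?v y powr (m / (m - 1)) = c powr (m / (m - 1)) * u y powr m"
      using c \<open>m > 1\<close> by (simp_all add: v powr_mult powr_powr)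
    have "(m - 2) / (m - 1) + m / (m - 1) = 2"
      using \<open>m > 1\<close> by (simp add: add_divide_distrib[symmetric] divide_eq_eq)
    then have "c powr ((m - 2) / (m - 1)) * c powr (m / (m - 1)) = c\<^sup>2"
      using c by (simp add: powr_add[symmetric])
    moreover have "u x powr (m - 2) = u x powr (m - 1) / u x"
      using u[of x] powr_diff[of "u x" "m - 1" 1] by simp
    ultimately show ?thesis
      unfolding x y by (simp add: v power2_eq_square)
  qed
  have "Psi_tilde k m ?v x = (\<Sum>y\<in>UNIV. (m - 1) * ?v x * (k x y *
      (u x powr (m - 1) / (m - 1) + u y powr m / u x - m / (m - 1) * u y powr (m - 1))))"
    unfolding Psi_tilde_def
  proof (rule sum.cong[OF refl])
    fix y
    have "(m - 1) / m * (?v x)\<^sup>2 = (m - 1) * ?v x * (u x powr (m - 1) / (m - 1))"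
      using \<open>m > 1\<close> by (simp add: v c_def power2_eq_square)
    moreover have "(m - 1)\<^sup>2 / m * (?v x powr ((m - 2) / (m - 1)) * ?v y powr (m / (m - 1)))
        = (m - 1) * ?v x * (u y powr m / u x)"
      unfolding power using \<open>m > 1\<close> by (simp add: c_def power2_eq_square)
    moreover have "(m - 1) * ?v x * ?v y = (m - 1) * ?v x * (m / (m - 1) * u y powr (m - 1))"
      by (simp add: v c_def)
    ultimately have "(m - 1) / m * (?v x)\<^sup>2
        + (m - 1)\<^sup>2 / m * ?v x powr ((m - 2) / (m - 1)) * ?v y powr (m / (m - 1))
        - (m - 1) * ?v x * ?v y
      = (m - 1) * ?v x *
        (u x powr (m - 1) / (m - 1) + u y powr m / u x - m / (m - 1) * u y powr (m - 1))"
      by (simp only: mult.assoc distrib_left right_diff_distrib)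
    then show "k x y * ((m - 1) / m * (?v x)\<^sup>2
        + (m - 1)\<^sup>2 / m * ?v x powr ((m - 2) / (m - 1)) * ?v y powr (m / (m - 1))
        - (m - 1) * ?v x * ?v y)
      = (m - 1) * ?v x * (k x y *
        (u x powr (m - 1) / (m - 1) + u y powr m / u x - m / (m - 1) * u y powr (m - 1)))"
      by simp
  qed
  then show ?thesis
    using \<open>m > 1\<close> v_pos[of x] by (simp add: sum_distrib_left[symmetric])
qed

text \<open>This is the case \<alpha> = 1 of G: the terms in \<open>u y powr (m - 1)\<close> cancel.
  It links the two inequalities of the theorem, because the right-hand side is the time derivative
  of v divided by (m-1)v along a solution.\<close>

lemma gen_add_Psi_tilde_pressure:
  fixes u :: "'a::finite \<Rightarrow> real"
  assumes "m > 1" and u: "\<And>y. u y > 0"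
  shows "gen k (pressure m u) x + Psi_tilde k m (pressure m u) x / ((m - 1) * pressure m u x)
    = gen k (\<lambda>y. u y powr m) x / u x"
proof -
  define c where "c = m / (m - 1)"
  \<comment> \<open>Here 1/(m-1) = c - 1, which makes the remaining identity polynomial in
    \<open>c\<close>.\<close>
  have c: "u x powr (m - 1) / (m - 1) = (c - 1) * u x powr (m - 1)"
    using \<open>m > 1\<close> by (simp add: c_def field_simps)
  have ux: "u x powr (m - 1) = u x powr m / u x"
    using u[of x] by (simp add: powr_diff)
  have "k x y * (c * (u y powr (m - 1) - u x powr (m - 1)))
      + k x y * ((c - 1) * u x powr (m - 1) + u y powr m / u x - c * u y powr (m - 1))
    = k x y * (u y powr m - u x powr m) / u x" for y
    unfolding times_divide_eq_right[symmetric] diff_divide_distrib ux[symmetric]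
    by (simp only: algebra_simps)
  then show ?thesis
    unfolding gen_pressure Psi_tilde_pressure[OF assms] gen_def[of k "\<lambda>y. u y powr m"]
      sum_divide_distrib sum.distrib[symmetric] c c_def[symmetric]
    by simp
qed

text \<open>G interpolates between Lv and Lu^m / u with weights 1-\<alpha> and \<alpha>. In this
  form only powers of \<open>u\<close> and a division by \<open>u x\<close> remain, so G can be
  differentiated and shown continuous summand by summand.\<close>

lemma G_op_pressure:
  fixes u :: "'a::finite \<Rightarrow> real"
  assumes "m > 1" and u: "\<And>y. u y > 0"
  shows "G_op k m \<alpha> (pressure m u) x = (\<Sum>y\<in>UNIV. k x y *
    ((1 - \<alpha>) * (m / (m - 1)) * (u y powr (m - 1) - u x powr (m - 1))
      + \<alpha> * (u y powr m / u x - u x powr (m - 1))))"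
proof -
  define c where "c = m / (m - 1)"
  have c: "u x powr (m - 1) / (m - 1) = (c - 1) * u x powr (m - 1)"
    using \<open>m > 1\<close> by (simp add: c_def field_simps)
  \<comment> \<open>The variable \<open>q\<close> stands for \<open>u y powr m / u x\<close>, kept
    opaque so that the identity is purely polynomial.\<close>
  have "k x y * (c * (u y powr (m - 1) - u x powr (m - 1)))
      + \<alpha> * (k x y * ((c - 1) * u x powr (m - 1) + q - c * u y powr (m - 1)))
    = k x y * ((1 - \<alpha>) * c * (u y powr (m - 1) - u x powr (m - 1))
      + \<alpha> * (q - u x powr (m - 1)))" for y q
    by (simp add: algebra_simps)
  then show ?thesis
    unfolding G_op_def gen_pressure Psi_tilde_pressure[OF assms] sum_distrib_left
      sum.distrib[symmetric] c c_def[symmetric]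
    by simp
qed

section \<open>Time derivative and continuity along positive solutions\<close>

lemma has_derivative_pressure:
  assumes "m > 1" "u t x > 0" "((\<lambda>s. u s x) has_real_derivative D) (at t)"
  shows "((\<lambda>s. pressure m (u s) x) has_real_derivative m * u t x powr (m - 2) * D) (at t)"
  unfolding pressure_def
  using DERIV_cmult[OF DERIV_fun_powr[where r = "m - 1", OF assms(3,2)], of "m / (m - 1)"] \<open>m > 1\<close>
  by (simp add: mult.assoc)

text \<open>Differentiating the sum in \<open>G_op_pressure\<close> and replacing each time
  derivative of \<open>u\<close> by Lu^m produces exactly the summands of
  \<open>D_op\<close>.\<close>

lemma has_derivative_G_op_pressure:
  fixes u :: "real \<Rightarrow> 'a::finite \<Rightarrow> real"
  assumes "m > 1" and u: "\<And>s y. s > 0 \<Longrightarrow> u s y > 0" and "t > 0"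
    and der: "\<And>y. ((\<lambda>s. u s y) has_real_derivative gen k (\<lambda>z. u t z powr m) y) (at t)"
  shows "((\<lambda>s. G_op k m \<alpha> (pressure m (u s)) x) has_real_derivative D_op k m \<alpha> (u t) x) (at t)"
proof -
  define w where "w y = gen k (\<lambda>z. u t z powr m) y" for y
  have der': "((\<lambda>s. u s y) has_real_derivative w y) (at t)" for y
    using der by (simp add: w_def)
  have powr_der: "((\<lambda>s. u s y powr r) has_real_derivative r * u t y powr (r - 1) * w y) (at t)" for y r
    using DERIV_fun_powr[OF der' u[OF \<open>t > 0\<close>]] by simp
  have summand: "((\<lambda>s. k x y *
      ((1 - \<alpha>) * (m / (m - 1)) * (u s y powr (m - 1) - u s x powr (m - 1))
        + \<alpha> * (u s y powr m / u s x - u s x powr (m - 1))))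
    has_real_derivative k x y *
      ((1 - \<alpha> + \<alpha> * (u t y / u t x)) * m * u t y powr (m - 2) * w y
        - (m - \<alpha> + \<alpha> * (u t y / u t x) powr m) * u t x powr (m - 2) * w x)) (at t)" for y
  proof -
    have pos: "u t x > 0" "u t y > 0" using u \<open>t > 0\<close> by auto
    \<comment> \<open>These are the atoms of a summand of \<open>D_op\<close>. Once the derivatives
      of the powers and of the quotient are expressed through them, the comparison is an algebraic
      identity.\<close>
    define P Q q R where "P = u t y powr (m - 2)" and "Q = u t x powr (m - 2)"
      and "q = u t y / u t x" and "R = (u t y / u t x) powr m"
    have "u t y powr (m - 1) = u t y * P"
      using pos powr_add[of "u t y" 1 "m - 2"] by (simp add: P_def)
    moreover have "u t y powr m = R * (Q * (u t x * u t x))"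
      using pos powr_add[of "u t x" 2 "m - 2"]
      by (simp add: R_def Q_def powr_divide power2_eq_square mult.commute)
    ultimately have quotient: "(m * u t y powr (m - 1) * w y * u t x - u t y powr m * w x)
        / (u t x * u t x) = m * P * w y * q - R * Q * w x"
      using pos by (simp add: q_def field_simps)
    have "(1 - \<alpha>) * (m / (m - 1)) * ((m - 1) * P * w y - (m - 1) * Q * w x)
      = (1 - \<alpha>) * (m / (m - 1) * (m - 1)) * (P * w y - Q * w x)"
      by (simp only: algebra_simps)
    also have "m / (m - 1) * (m - 1) = m" using \<open>m > 1\<close> by simp
    finally have difference: "(1 - \<alpha>) * (m / (m - 1)) * ((m - 1) * P * w y - (m - 1) * Q * w x)
      = (1 - \<alpha>) * m * (P * w y - Q * w x)" .
    have two: "m - 1 - 1 = m - 2" by simp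
    have "k x y * ((1 - \<alpha>) * (m / (m - 1)) *
          ((m - 1) * u t y powr (m - 1 - 1) * w y - (m - 1) * u t x powr (m - 1 - 1) * w x)
        + \<alpha> * ((m * u t y powr (m - 1) * w y * u t x - u t y powr m * w x) / (u t x * u t x)
          - (m - 1) * u t x powr (m - 1 - 1) * w x))
      = k x y * ((1 - \<alpha> + \<alpha> * q) * m * P * w y - (m - \<alpha> + \<alpha> * R) * Q * w x)"
      unfolding two quotient P_def[symmetric] Q_def[symmetric] difference
      by (simp add: algebra_simps)
    then show ?thesis
      unfolding P_def Q_def q_def R_def using pos
      by (intro DERIV_cong[OF DERIV_cmult[OF DERIV_add[OF DERIV_cmult[OF DERIV_diff[OF
                powr_der powr_der]] DERIV_cmult[OF DERIV_diff[OF DERIV_divide[OF powr_der der']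
                powr_der]]]]]) simp_all
  qed
  have "((\<lambda>s. \<Sum>y\<in>UNIV. k x y *
      ((1 - \<alpha>) * (m / (m - 1)) * (u s y powr (m - 1) - u s x powr (m - 1))
        + \<alpha> * (u s y powr m / u s x - u s x powr (m - 1))))
    has_real_derivative D_op k m \<alpha> (u t) x) (at t)"
    unfolding D_op_def w_def[symmetric] by (rule DERIV_sum[OF summand])
  \<comment> \<open>The explicit formula for G needs positivity of \<open>u s\<close>, assumed only
    for \<open>s > 0\<close>; a neighbourhood of \<open>t\<close> suffices for the
    derivative.\<close>
  moreover have "\<forall>\<^sub>F s in nhds t. s > 0"
    using \<open>t > 0\<close> eventually_nhds_in_open[of "{0<..}" t] by simp
  then have "\<forall>\<^sub>F s in nhds t. G_op k m \<alpha> (pressure m (u s)) x = (\<Sum>y\<in>UNIV. k x y *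
      ((1 - \<alpha>) * (m / (m - 1)) * (u s y powr (m - 1) - u s x powr (m - 1))
        + \<alpha> * (u s y powr m / u s x - u s x powr (m - 1))))"
    by eventually_elim (rule G_op_pressure[OF \<open>m > 1\<close> u])
  ultimately show ?thesis
    by (simp only: DERIV_cong_ev[OF refl _ refl])
qed

lemma continuous_on_G_op_pressure:
  fixes u :: "real \<Rightarrow> 'a::finite \<Rightarrow> real"
  assumes "m > 1" and u: "\<And>s y. s \<in> S \<Longrightarrow> u s y > 0"
    and cont: "\<And>y. continuous_on S (\<lambda>s. u s y)"
  shows "continuous_on S (\<lambda>s. G_op k m \<alpha> (pressure m (u s)) x)"
proof -
  have nz: "\<forall>s\<in>S. u s y \<noteq> 0" for y
    using u[of _ y] by force
  have "continuous_on S (\<lambda>s. \<Sum>y\<in>UNIV. k x y *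
      ((1 - \<alpha>) * (m / (m - 1)) * (u s y powr (m - 1) - u s x powr (m - 1))
        + \<alpha> * (u s y powr m / u s x - u s x powr (m - 1))))"
    by (intro continuous_intros continuous_on_powr cont nz)
  then show ?thesis
    by (rule continuous_on_cong[THEN iffD1, OF refl, rotated])
      (simp add: G_op_pressure[OF \<open>m > 1\<close> u])
qed

text \<open>\<open>deriv\<close> has a value even where no derivative exists, so differentiability
  comes from \<open>C1_in_time\<close>; at an interior time the one-sided filter is the full
  one.\<close>

lemma PME_has_derivative:
  fixes u :: "real \<Rightarrow> 'a::finite \<Rightarrow> real"
  assumes "C1_in_time u" "solves_PME k m u" "t > 0"
  shows "((\<lambda>s. u s x) has_real_derivative gen k (\<lambda>z. u t z powr m) x) (at t)"
proof -
  obtain u' where "\<forall>t\<ge>0. ((\<lambda>s. u s x) has_real_derivative u' t) (at t within {0..})"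
    using assms(1) unfolding C1_in_time_def by blast
  then have "((\<lambda>s. u s x) has_real_derivative u' t) (at t within {0..})"
    using \<open>t > 0\<close> by simp
  moreover have "at t within {0..} = at t"
    using \<open>t > 0\<close> by (intro at_within_open_subset[of t "{0<..}"]) auto
  ultimately have D: "((\<lambda>s. u s x) has_real_derivative u' t) (at t)"
    by simp
  also have "u' t = deriv (\<lambda>s. u s x) t"
    using DERIV_imp_deriv[OF D] by simp
  also have "\<dots> = gen k (\<lambda>z. u t z powr m) x"
    using assms(2,3) by (simp add: solves_PME_def)
  finally show ?thesis .
qed

lemma C1_in_time_continuous_on:
  assumes "C1_in_time u"
  shows "continuous_on {0..} (\<lambda>s. u s x)"
  using assms unfolding C1_in_time_def continuous_on_eq_continuous_within
  by (metis atLeast_iff DERIV_continuous)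

theorem theorem5p1:
  fixes k :: "'a::finite \<Rightarrow> 'a \<Rightarrow> real"
    and m d \<alpha> :: real
    and u v :: "real \<Rightarrow> 'a \<Rightarrow> real"
  assumes "m > 1"
    and "is_kernel k"
    and "d > 0"
    and "0 \<le> \<alpha>" "\<alpha> \<le> 1"
    and "CD0 k m \<alpha> d"
    and "\<And>t x. t \<ge> 0 \<Longrightarrow> u t x > 0"
    and "C1_in_time u"
    and "solves_PME k m u"
    and "\<And>t. v t = pressure m (u t)"
  shows "(\<forall>t>0. \<forall>x.
            - (gen k (v t) x + \<alpha> * (Psi_tilde k m (v t) x / ((m - 1) * v t x))) \<le> d / t) \<and>
         (\<forall>t>0. \<forall>x.
            (1 - \<alpha>) * (Psi_tilde k m (v t) x / ((m - 1) * v t x))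
              - deriv (\<lambda>s. v s x) t / ((m - 1) * v t x) \<le> d / t)"
proof -
  have u: "\<And>t x. t > 0 \<Longrightarrow> u t x > 0" using assms(7) by simp
  note du = PME_has_derivative[OF assms(8,9)]
  have bound: "- G_op k m \<alpha> (v t) x \<le> d / t" if "t > 0" for t x
  proof (rule riccati_maximum_principle[where F = "\<lambda>t x. - G_op k m \<alpha> (v t) x"
        and F' = "\<lambda>t x. - D_op k m \<alpha> (u t) x"])
    show "continuous_on {0..} (\<lambda>t. - G_op k m \<alpha> (v t) y)" for y
      unfolding assms(10)
      by (intro continuous_on_minus continuous_on_G_op_pressure C1_in_time_continuous_on assms)
        (simp add: assms(7))
    show "((\<lambda>s. - G_op k m \<alpha> (v s) y) has_real_derivative - D_op k m \<alpha> (u s) y) (at s)"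
      if "s > 0" for s y
      unfolding assms(10)
      by (intro DERIV_minus has_derivative_G_op_pressure assms(1) u du that)
    show "- D_op k m \<alpha> (u s) y \<le> - (1 / d * (- G_op k m \<alpha> (v s) y)\<^sup>2)"
      if "s > 0" "- G_op k m \<alpha> (v s) y > 0" "\<And>z. - G_op k m \<alpha> (v s) z \<le> - G_op k m \<alpha> (v s) y"
      for s y
    proof -
      \<comment> \<open>The curvature condition compares -G only with states reachable by a jump;
        maximality over all states covers these.\<close>
      have "1 / d * (- G_op k m \<alpha> (pressure m (u s)) y)\<^sup>2 \<le> D_op k m \<alpha> (u s) y"
        using \<open>CD0 k m \<alpha> d\<close>[unfolded CD0_def CD0_at_def Let_def, rule_format, of "u s" y]
          that u[OF \<open>s > 0\<close>]
        unfolding assms(10) by simp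
      then show ?thesis by (simp add: assms(10))
    qed
  qed (use that \<open>d > 0\<close> in auto)
  \<comment> \<open>The left-hand side of the second inequality equals -G, so it obeys the same
    bound.\<close>
  have "(1 - \<alpha>) * (Psi_tilde k m (v t) x / ((m - 1) * v t x))
      - deriv (\<lambda>s. v s x) t / ((m - 1) * v t x) = - G_op k m \<alpha> (v t) x" if "t > 0" for t x
  proof -
    have "deriv (\<lambda>s. v s x) t = m * u t x powr (m - 2) * gen k (\<lambda>y. u t y powr m) x"
      unfolding assms(10)
      by (intro DERIV_imp_deriv has_derivative_pressure assms(1) u du that)
    \<comment> \<open>The factor \<open>m * u t x powr (m - 2)\<close> also occurs in the derivative
      of v and cancels, leaving Lu^m / u.\<close>
    moreover have "(m - 1) * v t x = m * u t x powr (m - 2) * u t x"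
      using \<open>m > 1\<close> u[OF that, of x] powr_add[of "u t x" "m - 2" 1]
      by (simp add: assms(10) pressure_def)
    ultimately have "deriv (\<lambda>s. v s x) t / ((m - 1) * v t x) = gen k (\<lambda>y. u t y powr m) x / u t x"
      using \<open>m > 1\<close> u[OF that, of x] by simp
    also have "\<dots> = gen k (v t) x + Psi_tilde k m (v t) x / ((m - 1) * v t x)"
      unfolding assms(10) by (rule gen_add_Psi_tilde_pressure[OF assms(1) u[OF that], symmetric])
    finally show ?thesis
      unfolding G_op_def by (simp only: left_diff_distrib)
  qed
  with bound show ?thesis
    by (simp add: G_op_def)
qed

end
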